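(* Let $f$ be a calibrator, and for every integer $k\ge1$ and $\mathbf p=(p_1,\dots,p_k)\in[0,1]^k$ define $$F(\mathbf p)=\inf\left\{\alpha\in(0,1):\ \bigvee_{j=1}^k\left(\frac1j\sum_{i=1}^j f\left(\frac{p_i}{\alpha}\right)\right)\ge1\right\},\qquad \inf\varnothing=1 .$$ Let $P_1,P_2,\dots$ be an infinite exchangeable sequence of random variables, each uniformly distributed on $[0,1]$, and let $\mathbf P_k=(P_1,\dots,P_k)$. Then for every $\alpha\in(0,1)$, $$\mathbb P\left(\exists\,k\ge1:\ F(\mathbf P_k)\le\alpha\right)\le\alpha .$$
   Context: $\bigvee$ denotes maximum. A calibrator is a decreasing (non-increasing) function $f:[0,\infty)\to[0,\infty]$ with $f=0$ on $(1,\infty)$ and $\int_0^1 f(p)\,\mathrm dp\le1$. An infinite sequence is exchangeable if for every $n$ the distribution of $(P_1,\dots,P_n)$ is invariant under every permutation of its components. *)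

theory Defs
  imports "HOL-Probability.Probability"
begin

(* The domain of a calibrator is [0,oo); its values at negative reals are irrelevant.
   Monotonicity makes f measurable on {0..1}, so the integral below is the Lebesgue integral. *)
definition calibrator :: "(real \<Rightarrow> ennreal) \<Rightarrow> bool" where
  "calibrator f \<longleftrightarrow>
     antimono_on {0..} f \<and> (\<forall>x>1. f x = 0) \<and> (\<integral>\<^sup>+ x\<in>{0..1}. f x \<partial>lborel) \<le> 1"

(* ps ! i is the component p_{i+1}; the average is formed in [0,oo].
   Only used for nonempty ps (Max {} is unspecified). *)
definition max_running_average :: "(real \<Rightarrow> ennreal) \<Rightarrow> real list \<Rightarrow> real \<Rightarrow> ennreal" where
  "max_running_average f ps \<alpha> =
     (MAX j\<in>{1..length ps}. (1 / of_nat j) * (\<Sum>i<j. f (ps ! i / \<alpha>)))"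

definition rejection_levels :: "(real \<Rightarrow> ennreal) \<Rightarrow> real list \<Rightarrow> real set" where
  "rejection_levels f ps = {\<alpha>\<in>{0<..<1}. max_running_average f ps \<alpha> \<ge> 1}"

(* The merging function F on [0,1]^k, with k = length ps \<ge> 1 and Inf {} = 1.
   Outside [0,1]^k it gets the dummy value 1; for uniformly distributed p-values this
   concerns a null event only. *)
definition ex_p_merge :: "(real \<Rightarrow> ennreal) \<Rightarrow> real list \<Rightarrow> real" where
  "ex_p_merge f ps =
     (if set ps \<subseteq> {0..1} \<and> rejection_levels f ps \<noteq> {} then Inf (rejection_levels f ps) else 1)"

definition exchangeable :: "'a measure \<Rightarrow> (nat \<Rightarrow> 'a \<Rightarrow> real) \<Rightarrow> bool" where
  "exchangeable M P \<longleftrightarrow>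
     (\<forall>n \<pi>. \<pi> permutes {..<n} \<longrightarrow>
        distr M (\<Pi>\<^sub>M i\<in>{..<n}. borel) (\<lambda>\<omega>. \<lambda>i\<in>{..<n}. P (\<pi> i) \<omega>) =
        distr M (\<Pi>\<^sub>M i\<in>{..<n}. borel) (\<lambda>\<omega>. \<lambda>i\<in>{..<n}. P i \<omega>))"

end

theory Submission
  imports Defs
begin

text \<open>
  For nonnegative exchangeable $X_1, X_2, \dots$ and a horizon $n$, let $T$ be the \<^emph>\<open>last\<close>
  $k \le n$ with $X_1 + \dots + X_k \ge k$. The event $T = k$ is symmetric in $X_1, \dots, X_k$, so
  on it $X_1$ has the same integral as the average of $X_1, \dots, X_k$, which is at least $1$.
  Summing over $k$, the probability that some running average up to $n$ reaches $1$ is at most the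
  expectation of $X_1$. With $X_i = f(P_i/\beta)$ this expectation is at most $\beta$.
  Since rejection at a level is inherited by larger levels, $F(\mathbf P_k) \le \alpha$
  means rejection at every $\beta \in (\alpha, 1)$.
\<close>

section \<open>A maximal inequality for exchangeable sequences\<close>

lemma exchangeable_nn_integral_permute:
  assumes "exchangeable M P" and P [measurable]: "\<And>i. P i \<in> borel_measurable M"
    and \<pi>: "\<pi> permutes {..<n}" and h: "h \<in> borel_measurable (\<Pi>\<^sub>M i\<in>{..<n}. borel)"
  shows "(\<integral>\<^sup>+ \<omega>. h (\<lambda>i\<in>{..<n}. P (\<pi> i) \<omega>) \<partial>M) = (\<integral>\<^sup>+ \<omega>. h (\<lambda>i\<in>{..<n}. P i \<omega>) \<partial>M)"
proof -
  have "(\<integral>\<^sup>+ \<omega>. h (\<lambda>i\<in>{..<n}. P (\<pi> i) \<omega>) \<partial>M) =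
      (\<integral>\<^sup>+ x. h x \<partial>distr M (\<Pi>\<^sub>M i\<in>{..<n}. borel) (\<lambda>\<omega>. \<lambda>i\<in>{..<n}. P (\<pi> i) \<omega>))"
    by (rule nn_integral_distr[symmetric]) (use h in measurable)
  also have "\<dots> = (\<integral>\<^sup>+ x. h x \<partial>distr M (\<Pi>\<^sub>M i\<in>{..<n}. borel) (\<lambda>\<omega>. \<lambda>i\<in>{..<n}. P i \<omega>))"
    using assms(1) \<pi> unfolding exchangeable_def by simp
  also have "\<dots> = (\<integral>\<^sup>+ \<omega>. h (\<lambda>i\<in>{..<n}. P i \<omega>) \<partial>M)"
    by (rule nn_integral_distr) (use h in measurable)
  finally show ?thesis .
qed

text \<open>The event T = k of the overview for X_i = \<open>g (x i)\<close>. Comparing the sum with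
  k, rather than the average with 1, avoids division in \<open>ennreal\<close>.\<close>

definition last_crossing :: "(real \<Rightarrow> ennreal) \<Rightarrow> nat \<Rightarrow> nat \<Rightarrow> (nat \<Rightarrow> real) \<Rightarrow> bool" where
  "last_crossing g n k x \<longleftrightarrow> of_nat k \<le> (\<Sum>i<k. g (x i)) \<and>
     (\<forall>l\<in>{k<..n}. \<not> of_nat l \<le> (\<Sum>i<l. g (x i)))"

text \<open>Only sums of length at least k occur in the event, and these ignore the order of the
  first k entries. A first crossing time would involve shorter sums and lose this symmetry.\<close>

lemma last_crossing_permute:
  assumes "\<pi> permutes {..<k}"
  shows "last_crossing g n k (\<lambda>i. x (\<pi> i)) = last_crossing g n k x"
proof -
  have "(\<Sum>i<l. g (x (\<pi> i))) = (\<Sum>i<l. g (x i))" if "k \<le> l" for l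
  proof -
    have "\<pi> permutes {..<l}"
      using permutes_subset[OF assms] that by auto
    from sum.permute[OF this, of "\<lambda>i. g (x i)"] show ?thesis
      by (simp add: o_def)
  qed
  then show ?thesis
    by (auto simp: last_crossing_def)
qed

text \<open>Lets the event be read off the restricted tuple on the finite product space, where
  exchangeability is stated.\<close>

lemma last_crossing_cong:
  assumes "k \<le> n" "\<And>i. i < n \<Longrightarrow> x i = y i"
  shows "last_crossing g n k x = last_crossing g n k y"
proof -
  have "(\<Sum>i<l. g (x i)) = (\<Sum>i<l. g (y i))" if "l \<le> n" for l
    using that assms(2) by (intro sum.cong) auto
  then show ?thesis
    using assms(1) by (auto simp: last_crossing_def)
qed

lemma nn_integral_last_crossing_swap:
  assumes "exchangeable M P" and P: "\<And>i. P i \<in> borel_measurable M"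
    and g [measurable]: "g \<in> borel_measurable borel" and "i < k" "k \<le> n"
  shows "(\<integral>\<^sup>+ \<omega>. g (P i \<omega>) * indicator {\<omega>. last_crossing g n k (\<lambda>i. P i \<omega>)} \<omega> \<partial>M) =
    (\<integral>\<^sup>+ \<omega>. g (P 0 \<omega>) * indicator {\<omega>. last_crossing g n k (\<lambda>i. P i \<omega>)} \<omega> \<partial>M)"
proof -
  define h where "h x = (if last_crossing g n k x then g (x 0) else 0)" for x
  \<comment> \<open>Swapping 0 and i, both below k, carries \<open>g (x 0)\<close> to
    \<open>g (x i)\<close> and fixes the event. The swap is viewed on \<open>{..<k}\<close> for the
    symmetry of the event and on \<open>{..<n}\<close> for exchangeability.\<close>
  define \<pi> where "\<pi> = Transposition.transpose 0 i"
  have \<pi>: "\<pi> permutes {..<k}" "\<pi> permutes {..<n}"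
    using assms unfolding \<pi>_def by (auto intro!: permutes_swap_id)
  have [measurable]: "(\<lambda>x. x j) \<in> borel_measurable (\<Pi>\<^sub>M i\<in>{..<n}. borel)" if "j < n" for j
    using that by (intro measurable_component_singleton) simp
  have [measurable]: "(\<lambda>x. \<Sum>i<l. g (x i)) \<in> borel_measurable (\<Pi>\<^sub>M i\<in>{..<n}. borel)" if "l \<le> n" for l
    using that by (intro borel_measurable_sum measurable_compose[OF _ g]) auto
  have [measurable]: "Measurable.pred (\<Pi>\<^sub>M i\<in>{..<n}. borel) (last_crossing g n k)"
    unfolding last_crossing_def using \<open>k \<le> n\<close> by measurable
  have h: "h \<in> borel_measurable (\<Pi>\<^sub>M i\<in>{..<n}. borel)"
  proof -
    have [measurable]: "(\<lambda>x. g (x 0)) \<in> borel_measurable (\<Pi>\<^sub>M i\<in>{..<n}. borel)"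
      using assms by (intro measurable_compose[OF _ g]) auto
    show ?thesis
      unfolding h_def by measurable
  qed
  have lc: "last_crossing g n k (\<lambda>i\<in>{..<n}. x i) = last_crossing g n k x" for x
    using \<open>k \<le> n\<close> by (intro last_crossing_cong) auto
  have lp: "last_crossing g n k (\<lambda>j. P (\<pi> j) \<omega>) = last_crossing g n k (\<lambda>j. P j \<omega>)" for \<omega>
    by (rule last_crossing_permute[OF \<pi>(1)])
  have \<pi>_0: "\<pi> 0 = i"
    by (simp add: \<pi>_def)
  have "(\<integral>\<^sup>+ \<omega>. g (P i \<omega>) * indicator {\<omega>. last_crossing g n k (\<lambda>i. P i \<omega>)} \<omega> \<partial>M) =
      (\<integral>\<^sup>+ \<omega>. h (\<lambda>i\<in>{..<n}. P (\<pi> i) \<omega>) \<partial>M)"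
    using \<open>i < k\<close> \<open>k \<le> n\<close>
    by (intro nn_integral_cong) (simp add: h_def lc lp \<pi>_0)
  also have "\<dots> = (\<integral>\<^sup>+ \<omega>. h (\<lambda>i\<in>{..<n}. P i \<omega>) \<partial>M)"
    by (rule exchangeable_nn_integral_permute[OF assms(1) P \<pi>(2) h])
  also have "\<dots> = (\<integral>\<^sup>+ \<omega>. g (P 0 \<omega>) * indicator {\<omega>. last_crossing g n k (\<lambda>i. P i \<omega>)} \<omega> \<partial>M)"
    using \<open>i < k\<close> \<open>k \<le> n\<close>
    by (intro nn_integral_cong) (simp add: h_def lc)
  finally show ?thesis .
qed

text \<open>On the event the first k terms sum to at least k. Integrating gives k times the
  probability on one side and k equal integrals on the other; the factor k, nonzero and finite,
  cancels.\<close>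

lemma emeasure_last_crossing_le:
  assumes "exchangeable M P" and P [measurable]: "\<And>i. P i \<in> borel_measurable M"
    and g [measurable]: "g \<in> borel_measurable borel" and "1 \<le> k" "k \<le> n"
  shows "emeasure M {\<omega> \<in> space M. last_crossing g n k (\<lambda>i. P i \<omega>)} \<le>
    (\<integral>\<^sup>+ \<omega>. g (P 0 \<omega>) * indicator {\<omega>. last_crossing g n k (\<lambda>i. P i \<omega>)} \<omega> \<partial>M)"
    (is "emeasure M ?D \<le> ?I 0")
proof -
  let ?L = "{\<omega>. last_crossing g n k (\<lambda>i. P i \<omega>)}"
  have pred [measurable]: "Measurable.pred M (\<lambda>\<omega>. last_crossing g n k (\<lambda>i. P i \<omega>))"
    unfolding last_crossing_def by measurable
  have "of_nat k * emeasure M ?D = (\<integral>\<^sup>+ \<omega>. of_nat k * indicator ?D \<omega> \<partial>M)"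
    by (simp add: nn_integral_cmult_indicator)
  also have "\<dots> \<le> (\<integral>\<^sup>+ \<omega>. (\<Sum>i<k. g (P i \<omega>) * indicator ?L \<omega>) \<partial>M)"
    by (intro nn_integral_mono) (auto simp: indicator_def last_crossing_def)
  also have "\<dots> = (\<Sum>i<k. ?I i)"
    by (rule nn_integral_sum) measurable
  also have "\<dots> = (\<Sum>i<k. ?I 0)"
    by (intro sum.cong nn_integral_last_crossing_swap[OF assms(1-3) _ assms(5)]) simp_all
  also have "\<dots> = of_nat k * ?I 0"
    by (simp only: sum_constant card_lessThan)
  finally show ?thesis
    using \<open>1 \<le> k\<close> by (subst (asm) ennreal_mult_le_mult_iff) simp_all
qed

text \<open>Any crossing up to n entails a last one, so the events of last crossing at k = 1, ..., n
  cover the crossing event; being disjoint, they contribute in total at most the full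
  integral.\<close>

lemma emeasure_exchangeable_crossing_le_upto:
  assumes "exchangeable M P" and P [measurable]: "\<And>i. P i \<in> borel_measurable M"
    and g [measurable]: "g \<in> borel_measurable borel"
  shows "emeasure M {\<omega> \<in> space M. \<exists>k\<in>{1..n}. of_nat k \<le> (\<Sum>i<k. g (P i \<omega>))} \<le>
    (\<integral>\<^sup>+ \<omega>. g (P 0 \<omega>) \<partial>M)"
proof -
  let ?L = "\<lambda>k. {\<omega>. last_crossing g n k (\<lambda>i. P i \<omega>)}"
  define D where "D k = {\<omega> \<in> space M. last_crossing g n k (\<lambda>i. P i \<omega>)}" for k
  have pred [measurable]: "Measurable.pred M (\<lambda>\<omega>. last_crossing g n k (\<lambda>i. P i \<omega>))" for k
    unfolding last_crossing_def by measurable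
  have "\<exists>k\<in>{1..n}. \<omega> \<in> D k"
    if \<omega>: "\<omega> \<in> space M" "\<exists>k\<in>{1..n}. of_nat k \<le> (\<Sum>i<k. g (P i \<omega>))" for \<omega>
  proof -
    define K where "K = {k\<in>{1..n}. of_nat k \<le> (\<Sum>i<k. g (P i \<omega>))}"
    have K: "finite K" "K \<noteq> {}"
      using \<omega>(2) by (auto simp: K_def)
    then have "Max K \<in> K"
      by (rule Max_in)
    then have Max: "Max K \<in> {1..n}" "of_nat (Max K) \<le> (\<Sum>i<Max K. g (P i \<omega>))"
      unfolding K_def by blast+
    have "\<not> of_nat l \<le> (\<Sum>i<l. g (P i \<omega>))" if "l \<in> {Max K<..n}" for l
    proof
      assume "of_nat l \<le> (\<Sum>i<l. g (P i \<omega>))"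
      then have "l \<in> K"
        using that by (simp add: K_def)
      then show False
        using Max_ge[OF K(1)] that by fastforce
    qed
    with Max \<omega>(1) have "\<omega> \<in> D (Max K)"
      unfolding D_def last_crossing_def by blast
    with Max(1) show ?thesis
      by blast
  qed
  then have "emeasure M {\<omega> \<in> space M. \<exists>k\<in>{1..n}. of_nat k \<le> (\<Sum>i<k. g (P i \<omega>))} \<le>
      emeasure M (\<Union>k\<in>{1..n}. D k)"
    by (intro emeasure_mono) (auto simp: D_def)
  also have "\<dots> \<le> (\<Sum>k\<in>{1..n}. emeasure M (D k))"
    by (intro emeasure_subadditive_finite) (auto simp: D_def)
  also have "\<dots> \<le> (\<Sum>k\<in>{1..n}. \<integral>\<^sup>+ \<omega>. g (P 0 \<omega>) * indicator (?L k) \<omega> \<partial>M)"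
    unfolding D_def by (intro sum_mono emeasure_last_crossing_le assms) auto
  also have "\<dots> = (\<integral>\<^sup>+ \<omega>. (\<Sum>k\<in>{1..n}. g (P 0 \<omega>) * indicator (?L k) \<omega>) \<partial>M)"
    by (rule nn_integral_sum[symmetric]) measurable
  also have "\<dots> \<le> (\<integral>\<^sup>+ \<omega>. g (P 0 \<omega>) \<partial>M)"
  proof (rule nn_integral_mono)
    fix \<omega>
    \<comment> \<open>For k < l, a crossing at l contradicts that k is the last one.\<close>
    have "disjoint_family_on ?L {1..n}"
      unfolding disjoint_family_on_def
    proof (intro ballI impI)
      fix k l assume "k \<in> {1..n}" "l \<in> {1..n}" "k \<noteq> l"
      then show "?L k \<inter> ?L l = {}"
        by (cases "k < l") (auto simp: last_crossing_def)
    qed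
    then have "(\<Sum>k\<in>{1..n}. indicator (?L k) \<omega>) = (indicator (\<Union>k\<in>{1..n}. ?L k) \<omega> :: ennreal)"
      by (intro indicator_UN_disjoint[symmetric]) auto
    also have "\<dots> \<le> 1"
      by (simp add: indicator_def)
    finally have "g (P 0 \<omega>) * (\<Sum>k\<in>{1..n}. indicator (?L k) \<omega>) \<le> g (P 0 \<omega>) * 1"
      by (rule mult_left_mono) simp
    then show "(\<Sum>k\<in>{1..n}. g (P 0 \<omega>) * indicator (?L k) \<omega>) \<le> g (P 0 \<omega>)"
      by (simp only: sum_distrib_left mult_1_right)
  qed
  finally show ?thesis .
qed

text \<open>Continuity from below: the bound does not depend on the horizon n.\<close>

lemma emeasure_exchangeable_crossing_le:
  assumes "exchangeable M P" and P [measurable]: "\<And>i. P i \<in> borel_measurable M"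
    and g [measurable]: "g \<in> borel_measurable borel"
  shows "emeasure M {\<omega> \<in> space M. \<exists>k\<ge>1. of_nat k \<le> (\<Sum>i<k. g (P i \<omega>))} \<le>
    (\<integral>\<^sup>+ \<omega>. g (P 0 \<omega>) \<partial>M)"
proof -
  define A where "A n = {\<omega> \<in> space M. \<exists>k\<in>{1..n}. of_nat k \<le> (\<Sum>i<k. g (P i \<omega>))}" for n
  have "{\<omega> \<in> space M. \<exists>k\<ge>1. of_nat k \<le> (\<Sum>i<k. g (P i \<omega>))} = (\<Union>n. A n)"
    by (force simp: A_def)
  also have "emeasure M \<dots> = (SUP n. emeasure M (A n))"
  proof (rule SUP_emeasure_incseq[symmetric])
    show "range A \<subseteq> sets M"
      unfolding A_def by auto
    show "incseq A"
      by (rule incseq_SucI) (force simp: A_def)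
  qed
  also have "\<dots> \<le> (\<integral>\<^sup>+ \<omega>. g (P 0 \<omega>) \<partial>M)"
    unfolding A_def by (intro SUP_least emeasure_exchangeable_crossing_le_upto assms)
  finally show ?thesis .
qed

section \<open>Calibrators and the merging function\<close>

text \<open>A calibrator need not be measurable on the negative reals, so it is truncated there.\<close>

lemma calibrator_truncated_measurable:
  assumes "calibrator f"
  shows "(\<lambda>x. if 0 \<le> x then f x else 0) \<in> borel_measurable borel"
proof (rule borel_measurableI_greater)
  fix y :: ennreal
  \<comment> \<open>Superlevel sets lie in the nonnegative reals, where monotonicity of
    \<open>f\<close> makes them intervals.\<close>
  have "is_interval {x. y < (if 0 \<le> x then f x else 0)}"
    unfolding is_interval_1
  proof (intro ballI allI impI)
    fix a b x
    assume "a \<in> {x. y < (if 0 \<le> x then f x else 0)}" "b \<in> {x. y < (if 0 \<le> x then f x else 0)}"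
      "a \<le> x \<and> x \<le> b"
    then have "0 \<le> x" "x \<le> b" "y < f b"
      by (auto split: if_splits)
    moreover from this have "f b \<le> f x"
      using assms by (auto simp: calibrator_def monotone_on_def)
    ultimately show "x \<in> {x. y < (if 0 \<le> x then f x else 0)}"
      by auto
  qed
  then show "{x \<in> space borel. y < (if 0 \<le> x then f x else 0)} \<in> sets borel"
    by (simp add: real_interval_borel_measurable)
qed

text \<open>Rescaling by \<beta> pulls out the factor \<beta> and leaves the integral of
  \<open>f\<close> over [0, 1/\<beta>]. Since \<open>f\<close> vanishes beyond 1, this is at most
  its integral over [0, 1].\<close>

lemma calibrator_scaled_integral_le:
  assumes f: "calibrator f" and \<beta>: "0 < \<beta>"
  shows "(\<integral>\<^sup>+ x. (if 0 \<le> x / \<beta> then f (x / \<beta>) else 0) \<partial>uniform_measure lborel {0..1}) \<le> ennreal \<beta>"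
proof -
  define g where "g x = (if 0 \<le> x then f x else 0)" for x
  have g [measurable]: "g \<in> borel_measurable borel"
    using calibrator_truncated_measurable[OF f] by (simp add: g_def[abs_def])
  have "(\<integral>\<^sup>+ x. g (x / \<beta>) \<partial>uniform_measure lborel {0..1}) =
      (\<integral>\<^sup>+ x. g (x / \<beta>) * indicator {0..1} x \<partial>lborel)"
    by (subst nn_integral_uniform_measure) (auto simp: divide_ennreal_def)
  also have "\<dots> = ennreal \<beta> * (\<integral>\<^sup>+ x. g ((0 + \<beta> * x) / \<beta>) * indicator {0..1} (0 + \<beta> * x) \<partial>lborel)"
    using \<beta> by (subst nn_integral_real_affine[where c=\<beta> and t=0]) auto
  also have "\<dots> \<le> ennreal \<beta> * (\<integral>\<^sup>+ x\<in>{0..1}. f x \<partial>lborel)"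
    using \<beta> f
    by (intro mult_left_mono nn_integral_mono)
      (auto simp: g_def indicator_def calibrator_def)
  also have "\<dots> \<le> ennreal \<beta> * 1"
    using f by (intro mult_left_mono) (auto simp: calibrator_def)
  finally show ?thesis
    by (simp add: g_def)
qed

text \<open>Passes from averages to the sums used in the maximal inequality, multiplying by the
  finite nonzero j; the sums themselves may be infinite.\<close>

lemma max_running_average_ge_1_iff:
  assumes "ps \<noteq> []"
  shows "1 \<le> max_running_average f ps \<beta> \<longleftrightarrow>
    (\<exists>j\<in>{1..length ps}. of_nat j \<le> (\<Sum>i<j. f (ps ! i / \<beta>)))"
proof -
  have "1 \<le> (1 / of_nat j) * s \<longleftrightarrow> of_nat j \<le> s" if "1 \<le> j" for j and s :: ennreal
  proof -
    have "of_nat j * (1 / of_nat j) = (1 :: ennreal)"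
      using that by (simp add: ennreal_times_divide of_nat_less_top)
    then have "of_nat j * ((1 / of_nat j) * s) = s"
      by (simp add: mult.assoc[symmetric])
    then show ?thesis
      using ennreal_mult_le_mult_iff[of "of_nat j" 1 "(1 / of_nat j) * s"] that by simp
  qed
  moreover have "{1..length ps} \<noteq> {}"
    using assms by (cases ps) auto
  ultimately show ?thesis
    unfolding max_running_average_def by (subst Max_ge_iff) auto
qed

text \<open>A larger level makes every p/\<beta> smaller, hence every summand larger, as
  \<open>f\<close> is decreasing.\<close>

lemma rejection_levels_upward:
  assumes f: "calibrator f" and ps: "ps \<noteq> []" "set ps \<subseteq> {0..}"
    and \<gamma>: "\<gamma> \<in> rejection_levels f ps" and \<beta>: "\<gamma> \<le> \<beta>" "\<beta> < 1"
  shows "\<beta> \<in> rejection_levels f ps"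
proof -
  have "0 < \<gamma>"
    using \<gamma> by (simp add: rejection_levels_def)
  obtain j where j: "j \<in> {1..length ps}" "of_nat j \<le> (\<Sum>i<j. f (ps ! i / \<gamma>))"
    using \<gamma> ps by (auto simp: rejection_levels_def max_running_average_ge_1_iff)
  note j(2)
  also have "(\<Sum>i<j. f (ps ! i / \<gamma>)) \<le> (\<Sum>i<j. f (ps ! i / \<beta>))"
  proof (rule sum_mono)
    fix i assume "i \<in> {..<j}"
    then have "0 \<le> ps ! i"
      using j(1) subsetD[OF ps(2) nth_mem, of i] by auto
    then have "0 \<le> ps ! i / \<beta>" "ps ! i / \<beta> \<le> ps ! i / \<gamma>"
      using \<open>0 < \<gamma>\<close> \<beta> by (auto intro: divide_left_mono)
    then show "f (ps ! i / \<gamma>) \<le> f (ps ! i / \<beta>)"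
      using f by (auto simp: calibrator_def monotone_on_def)
  qed
  finally show ?thesis
    using j \<open>0 < \<gamma>\<close> \<beta> ps by (auto simp: rejection_levels_def max_running_average_ge_1_iff)
qed

text \<open>The infimum need not be attained, so a value of at most \<alpha> does not give rejection
  at \<alpha> itself, only at all higher levels below 1. A sequence tending to \<alpha> suffices to
  test these, which keeps the condition countable.\<close>

lemma ex_p_merge_le_iff:
  assumes f: "calibrator f" and ps: "ps \<noteq> []" and \<alpha>: "0 < \<alpha>" "\<alpha> < 1"
    and b: "b \<longlonglongrightarrow> \<alpha>" "\<And>m. b m \<in> {\<alpha><..<1}"
  shows "ex_p_merge f ps \<le> \<alpha> \<longleftrightarrow> set ps \<subseteq> {0..1} \<and> (\<forall>m::nat. b m \<in> rejection_levels f ps)"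
    (is "?L \<longleftrightarrow> ?R")
proof
  assume L: ?L
  \<comment> \<open>The default value 1 exceeds \<alpha>, so the infimum branch of
    \<open>ex_p_merge\<close> must apply.\<close>
  then have ps01: "set ps \<subseteq> {0..1}" and ne: "rejection_levels f ps \<noteq> {}"
    and Inf: "Inf (rejection_levels f ps) \<le> \<alpha>"
    using \<alpha> by (auto simp: ex_p_merge_def split: if_splits)
  have "b m \<in> rejection_levels f ps" for m
  proof -
    have "Inf (rejection_levels f ps) < b m"
      using Inf b(2)[of m] by auto
    then obtain \<gamma> where "\<gamma> \<in> rejection_levels f ps" "\<gamma> < b m"
      using cInf_lessD[OF ne] by blast
    then show ?thesis
      using rejection_levels_upward[OF f ps] ps01 b(2)[of m] by force
  qed
  with ps01 show ?R
    by simp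
next
  assume R: ?R
  then have "Inf (rejection_levels f ps) \<le> b m" for m
    by (intro cInf_lower bdd_belowI[where m=0]) (auto simp: rejection_levels_def)
  then have "Inf (rejection_levels f ps) \<le> \<alpha>"
    using b(1) by (intro LIMSEQ_le_const) auto
  with R show ?L
    by (auto simp: ex_p_merge_def)
qed

theorem theorem3p10:
  fixes M :: "'a measure" and P :: "nat \<Rightarrow> 'a \<Rightarrow> real"
    and f :: "real \<Rightarrow> ennreal" and \<alpha> :: real
  assumes "prob_space M"
    and "calibrator f"
    and "\<And>i. P i \<in> borel_measurable M"
    and "\<And>i. distr M borel (P i) = uniform_measure lborel {0..1}"
    and "exchangeable M P"
    and "\<alpha> \<in> {0<..<1}"
  shows "{\<omega> \<in> space M. \<exists>k\<ge>1. ex_p_merge f (map (\<lambda>i. P i \<omega>) [0..<k]) \<le> \<alpha>} \<in> sets M \<and>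
         measure M {\<omega> \<in> space M. \<exists>k\<ge>1. ex_p_merge f (map (\<lambda>i. P i \<omega>) [0..<k]) \<le> \<alpha>} \<le> \<alpha>"
proof -
  interpret prob_space M by fact
  note P [measurable] = assms(3)
  define g where "g x = (if 0 \<le> x then f x else 0)" for x
  have g [measurable]: "g \<in> borel_measurable borel"
    using calibrator_truncated_measurable[OF assms(2)] by (simp add: g_def[abs_def])
  \<comment> \<open>Levels converging to \<alpha> from above; the double \<open>Suc\<close> makes
    the denominator at least 2, so that already \<open>b 0\<close> is below 1.\<close>
  define b where "b m = \<alpha> + (1 - \<alpha>) / real (Suc (Suc m))" for m
  have "(\<lambda>m. (1 - \<alpha>) / real (Suc (Suc m))) \<longlonglongrightarrow> 0"
    by (intro LIMSEQ_Suc lim_const_over_n)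
  from tendsto_add[OF tendsto_const this, of \<alpha>] have b_lim: "b \<longlonglongrightarrow> \<alpha>"
    by (simp add: b_def[abs_def])
  have b: "b m \<in> {\<alpha><..<1}" for m
  proof -
    have "(1 - \<alpha>) / real (Suc (Suc m)) < (1 - \<alpha>) / 1"
      using assms(6) by (intro divide_strict_left_mono) auto
    then show ?thesis
      using assms(6) by (auto simp: b_def)
  qed
  let ?E = "{\<omega> \<in> space M. \<exists>k\<ge>1. ex_p_merge f (map (\<lambda>i. P i \<omega>) [0..<k]) \<le> \<alpha>}"
  \<comment> \<open>Rewrites the event with countable quantifiers and the Borel function
    \<open>g\<close>, so that it is visibly measurable. The truncation is harmless because all
    entries lie in [0, 1].\<close>
  have iff: "ex_p_merge f (map (\<lambda>i. P i \<omega>) [0..<k]) \<le> \<alpha> \<longleftrightarrow>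
      (\<forall>i<k. P i \<omega> \<in> {0..1}) \<and>
      (\<forall>m. \<exists>j\<in>{1..k}. of_nat j \<le> (\<Sum>i<j. g (P i \<omega> / b m)))" (is "_ \<longleftrightarrow> ?U \<and> ?V")
    if "1 \<le> k" for k \<omega>
  proof -
    let ?ps = "map (\<lambda>i. P i \<omega>) [0..<k]"
    have ps: "?ps \<noteq> []" "length ?ps = k"
      using that by auto
    have "set ?ps \<subseteq> {0..1} \<longleftrightarrow> ?U"
      by (auto simp: image_subset_iff)
    moreover have "b m \<in> rejection_levels f ?ps \<longleftrightarrow>
        (\<exists>j\<in>{1..k}. of_nat j \<le> (\<Sum>i<j. g (P i \<omega> / b m)))" if U: ?U for m
    proof -
      have pos: "0 < b m"
        using b[of m] assms(6) by auto
      have "(\<Sum>i<j. f (?ps ! i / b m)) = (\<Sum>i<j. g (P i \<omega> / b m))" if "j \<le> k" for j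
        using U that pos by (intro sum.cong) (auto simp: g_def)
      then show ?thesis
        using b[of m] pos ps by (auto simp: rejection_levels_def max_running_average_ge_1_iff)
    qed
    ultimately show ?thesis
      using ex_p_merge_le_iff[OF assms(2) ps(1) _ _ b_lim b] assms(6) by auto
  qed
  have "?E = {\<omega> \<in> space M. \<exists>k\<ge>1. (\<forall>i<k. P i \<omega> \<in> {0..1}) \<and>
      (\<forall>m. \<exists>j\<in>{1..k}. of_nat j \<le> (\<Sum>i<j. g (P i \<omega> / b m)))}"
    using iff by blast
  also have "\<dots> \<in> sets M"
    by measurable
  finally have E: "?E \<in> sets M" .
  have "emeasure M ?E \<le> ennreal (b m)" for m
  proof -
    have pos: "0 < b m"
      using b[of m] assms(6) by auto
    \<comment> \<open>One fixed level \<open>b m\<close> is kept and the range condition dropped;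
      the maximal inequality then applies to X_i = \<open>g (P i \<omega> / b m)\<close>.\<close>
    have "emeasure M ?E \<le>
        emeasure M {\<omega> \<in> space M. \<exists>k\<ge>1. of_nat k \<le> (\<Sum>i<k. g (P i \<omega> / b m))}"
    proof (rule emeasure_mono)
      show "?E \<subseteq> {\<omega> \<in> space M. \<exists>k\<ge>1. of_nat k \<le> (\<Sum>i<k. g (P i \<omega> / b m))}"
        using iff by fastforce
    qed measurable
    also have "\<dots> \<le> (\<integral>\<^sup>+ \<omega>. g (P 0 \<omega> / b m) \<partial>M)"
      by (rule emeasure_exchangeable_crossing_le[OF assms(5) P, where g="\<lambda>x. g (x / b m)"]) measurable
    also have "\<dots> = (\<integral>\<^sup>+ x. g (x / b m) \<partial>distr M borel (P 0))"
      by (rule nn_integral_distr[symmetric]) measurable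
    also have "\<dots> \<le> ennreal (b m)"
      unfolding assms(4) g_def using calibrator_scaled_integral_le[OF assms(2) pos] by simp
    finally show ?thesis .
  qed
  then have "measure M ?E \<le> b m" for m
    using b[of m] assms(6) by (auto simp: emeasure_eq_measure intro: iffD1[OF ennreal_le_iff])
  \<comment> \<open>The bound holds for every m, and \<open>b m\<close> tends to \<alpha>.\<close>
  then have "measure M ?E \<le> \<alpha>"
    by (intro LIMSEQ_le_const[OF b_lim]) auto
  with E show ?thesis
    by blast
qed

end
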